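(* Let $\mathcal{V}=(V_i)_{i\in I}$ be a collection of random vectors $V_i\in\mathbb{C}^{2\ell_i+1}$, $\ell_i\in\frac12\mathbb{N}$, defined on a common probability space, and let $\gamma\in SU(2)$ be a random element distributed with the Haar probability measure and independent from $\mathcal{V}$. Then: (a) $\mathcal{V}$ is strongly $D$-invariant if and only if $(V_i)_{i\in I}\overset{\text{law}}{=}(D^{\ell_i}(\gamma)V_i)_{i\in I}$; (b) (when all $V_i$ have finite second moments) $\mathcal{V}$ is $2$-weakly $D$-invariant if and only if $(V_i)_{i\in I}\sim_{\text{2-w}}(D^{\ell_i}(\gamma)V_i)_{i\in I}$, meaning that for all $i,j\in I$ the vectors $(V_i,V_j)$ and $(D^{\ell_i}(\gamma)V_i,D^{\ell_j}(\gamma)V_j)$ are $2$-weakly equivalent.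
   Context: $\frac12\mathbb{N}=\{0,\frac12,1,\dots\}$. For $\ell\in\frac12\mathbb{N}$, coordinates of $\mathbb{C}^{2\ell+1}$ are indexed by $m\in\{-\ell,-\ell+1,\dots,\ell\}$. The Wigner matrix $D^\ell=(D^\ell_{m,s})_{m,s}:SU(2)\to U(2\ell+1)$ is the unitary representation defined as follows: with $\psi^\ell_m(z_0,z_1)=\binom{2\ell}{\ell+m}^{1/2}z_0^{\ell+m}z_1^{\ell-m}$ and $g=\begin{pmatrix}\alpha&-\overline\beta\\ \beta&\overline\alpha\end{pmatrix}\in SU(2)$, $\sum_m\psi^\ell_m(z_0,z_1)D^\ell_{m,s}(g)=\psi^\ell_s(\overline\alpha z_0+\overline\beta z_1,-\beta z_0+\alpha z_1)$ for all $z_0,z_1\in\mathbb{C}$. Two random vectors $V,V'\in\mathbb{C}^N$ with finite second moments are $2$-weakly equivalent, $V\sim_{\text{2-w}}V'$, if $\mathbb{E}V=\mathbb{E}V'$, $\mathbb{E}\{V\overline{V}^T\}=\mathbb{E}\{V'\overline{V'}^T\}$ and $\mathbb{E}\{VV^T\}=\mathbb{E}\{V'(V')^T\}$. A collection $(V_i)_{i\in I}$ is strongly $D$-invariant if for every $g\in SU(2)$ its joint law equals that of $(D^{\ell_i}(g)V_i)_{i\in I}$; it is $2$-weakly $D$-invariant if $(V_i,V_j)\sim_{\text{2-w}}(D^{\ell_i}(g)V_i,D^{\ell_j}(g)V_j)$ for all $i,j\in I$ and $g\in SU(2)$. *)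

theory Defs
  imports "HOL-Probability.Probability"
begin

section \<open>The group SU(2) and its Haar probability measure\<close>

definition SU2 :: "(complex ^ 2 ^ 2) set" where
  "SU2 = {g. g ** (\<chi> i j. cnj (g $ j $ i)) = mat 1 \<and> det g = 1}"

abbreviation borel_SU2 :: "(complex ^ 2 ^ 2) measure" where
  "borel_SU2 \<equiv> restrict_space borel SU2"

text \<open>Left invariance suffices: on a compact group the left-invariant Borel probability measure is
  unique and also right-invariant.\<close>

definition haar_prob_SU2 :: "(complex ^ 2 ^ 2) measure \<Rightarrow> bool" where
  "haar_prob_SU2 \<mu> \<longleftrightarrow> prob_space \<mu> \<and> sets \<mu> = sets borel_SU2 \<and>
     (\<forall>g\<in>SU2. distr \<mu> borel_SU2 (\<lambda>h. g ** h) = \<mu>)"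


section \<open>Wigner matrices\<close>

definition half_nats :: "real set" where
  "half_nats = {l. 2 * l \<in> \<nat>}"

definition weights :: "real \<Rightarrow> real set" where
  "weights l = {m. - l \<le> m \<and> m \<le> l \<and> l + m \<in> \<nat>}"

text \<open>For half-natural \<open>l\<close> and \<open>m \<in> weights l\<close> the floors below are exact.\<close>

definition wigner_psi :: "real \<Rightarrow> real \<Rightarrow> complex \<Rightarrow> complex \<Rightarrow> complex" where
  "wigner_psi l m z0 z1 =
     of_real (sqrt (real (nat \<lfloor>2 * l\<rfloor> choose nat \<lfloor>l + m\<rfloor>))) *
     z0 ^ nat \<lfloor>l + m\<rfloor> * z1 ^ nat \<lfloor>l - m\<rfloor>"

text \<open>In \<open>SU2\<close> the entries \<open>\<alpha> = g $ 1 $ 1\<close> and \<open>\<beta> = g $ 2 $ 1\<close> determine \<open>g\<close>.  The \<open>s\<close>-th column of the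
  Wigner matrix is the unique solution \<open>c\<close> of the defining identity; lemma \<open>wigner_D_identity\<close> below
  shows that the description is proper.\<close>

definition wigner_D :: "real \<Rightarrow> complex ^ 2 ^ 2 \<Rightarrow> real \<Rightarrow> real \<Rightarrow> complex" where
  "wigner_D l g m s =
     (THE c. c \<in> extensional (weights l) \<and>
        (\<forall>z0 z1. (\<Sum>m\<in>weights l. wigner_psi l m z0 z1 * c m) =
           wigner_psi l s (cnj (g $ 1 $ 1) * z0 + cnj (g $ 2 $ 1) * z1)
                          (- (g $ 2 $ 1) * z0 + g $ 1 $ 1 * z1))) m"

definition wigner_act :: "real \<Rightarrow> complex ^ 2 ^ 2 \<Rightarrow> (real \<Rightarrow> complex) \<Rightarrow> (real \<Rightarrow> complex)" where
  "wigner_act l g v = (\<lambda>m\<in>weights l. \<Sum>s\<in>weights l. wigner_D l g m s * v s)"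


section \<open>Invariance of collections of random vectors\<close>

text \<open>The space \<open>\<complex>\<^sup>2\<^sup>l\<^sup>+\<^sup>1\<close>, its vectors being the extensional functions on \<open>weights l\<close>.\<close>

abbreviation vec_space :: "real \<Rightarrow> (real \<Rightarrow> complex) measure" where
  "vec_space l \<equiv> Pi\<^sub>M (weights l) (\<lambda>_. borel)"

definition joint_law ::
  "'w measure \<Rightarrow> 'i set \<Rightarrow> ('i \<Rightarrow> real) \<Rightarrow> ('i \<Rightarrow> 'w \<Rightarrow> real \<Rightarrow> complex) \<Rightarrow> ('i \<Rightarrow> real \<Rightarrow> complex) measure"
  where "joint_law M I l V = distr M (Pi\<^sub>M I (\<lambda>i. vec_space (l i))) (\<lambda>\<omega>. \<lambda>i\<in>I. V i \<omega>)"

text \<open>The joint variable takes values in a type different from that of \<open>\<gamma>\<close>, so the library's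
  \<open>indep_var\<close> does not apply; this is independence of the generated \<open>\<sigma>\<close>-algebras.\<close>

definition indep_of_collection ::
  "'w measure \<Rightarrow> 'i set \<Rightarrow> ('i \<Rightarrow> real) \<Rightarrow> ('i \<Rightarrow> 'w \<Rightarrow> real \<Rightarrow> complex) \<Rightarrow> ('w \<Rightarrow> complex ^ 2 ^ 2) \<Rightarrow> bool"
  where "indep_of_collection M I l V \<gamma> \<longleftrightarrow>
    prob_space.indep_set M
      {\<gamma> -` A \<inter> space M | A. A \<in> sets borel_SU2}
      {(\<lambda>\<omega>. \<lambda>i\<in>I. V i \<omega>) -` B \<inter> space M | B. B \<in> sets (Pi\<^sub>M I (\<lambda>i. vec_space (l i)))}"

definition strongly_D_invariant ::
  "'w measure \<Rightarrow> 'i set \<Rightarrow> ('i \<Rightarrow> real) \<Rightarrow> ('i \<Rightarrow> 'w \<Rightarrow> real \<Rightarrow> complex) \<Rightarrow> bool"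
  where "strongly_D_invariant M I l V \<longleftrightarrow>
    (\<forall>g\<in>SU2. joint_law M I l V = joint_law M I l (\<lambda>i \<omega>. wigner_act (l i) g (V i \<omega>)))"

definition finite_second_moments :: "'w measure \<Rightarrow> 'a set \<Rightarrow> ('w \<Rightarrow> 'a \<Rightarrow> complex) \<Rightarrow> bool" where
  "finite_second_moments M J X \<longleftrightarrow>
    (\<forall>a\<in>J. (\<lambda>\<omega>. X \<omega> a) \<in> borel_measurable M \<and> integrable M (\<lambda>\<omega>. (cmod (X \<omega> a))\<^sup>2))"

text \<open>Vectors with coordinates indexed by a finite set \<open>J\<close>; the matrix equations are written
  entrywise.\<close>

definition weakly2_equiv ::
  "'w measure \<Rightarrow> 'a set \<Rightarrow> ('w \<Rightarrow> 'a \<Rightarrow> complex) \<Rightarrow> ('w \<Rightarrow> 'a \<Rightarrow> complex) \<Rightarrow> bool"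
  where "weakly2_equiv M J X Y \<longleftrightarrow>
    finite_second_moments M J X \<and> finite_second_moments M J Y \<and>
    (\<forall>a\<in>J. (LINT \<omega>|M. X \<omega> a) = (LINT \<omega>|M. Y \<omega> a)) \<and>
    (\<forall>a\<in>J. \<forall>b\<in>J. (LINT \<omega>|M. X \<omega> a * cnj (X \<omega> b)) = (LINT \<omega>|M. Y \<omega> a * cnj (Y \<omega> b))) \<and>
    (\<forall>a\<in>J. \<forall>b\<in>J. (LINT \<omega>|M. X \<omega> a * X \<omega> b) = (LINT \<omega>|M. Y \<omega> a * Y \<omega> b))"

text \<open>The concatenation \<open>(V\<^sub>i, V\<^sub>j)\<close> is indexed by the disjoint sum of the two coordinate sets.\<close>

definition collection_weakly2_equiv ::
  "'w measure \<Rightarrow> 'i set \<Rightarrow> ('i \<Rightarrow> real) \<Rightarrow> ('i \<Rightarrow> 'w \<Rightarrow> real \<Rightarrow> complex) \<Rightarrow> ('i \<Rightarrow> 'w \<Rightarrow> real \<Rightarrow> complex) \<Rightarrow> bool"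
  where "collection_weakly2_equiv M I l V W \<longleftrightarrow>
    (\<forall>i\<in>I. \<forall>j\<in>I. weakly2_equiv M (weights (l i) <+> weights (l j))
       (\<lambda>\<omega>. case_sum (V i \<omega>) (V j \<omega>)) (\<lambda>\<omega>. case_sum (W i \<omega>) (W j \<omega>)))"

definition weakly2_D_invariant ::
  "'w measure \<Rightarrow> 'i set \<Rightarrow> ('i \<Rightarrow> real) \<Rightarrow> ('i \<Rightarrow> 'w \<Rightarrow> real \<Rightarrow> complex) \<Rightarrow> bool"
  where "weakly2_D_invariant M I l V \<longleftrightarrow>
    (\<forall>g\<in>SU2. collection_weakly2_equiv M I l V (\<lambda>i \<omega>. wigner_act (l i) g (V i \<omega>)))"


section \<open>The Wigner matrix is well defined\<close>

lemma SU2_form: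
  assumes "g \<in> SU2"
  shows "g $ 1 $ 2 = - cnj (g $ 2 $ 1)" and "g $ 2 $ 2 = cnj (g $ 1 $ 1)"
proof -
  define a b c d where abcd: "a = g $ 1 $ 1" "b = g $ 1 $ 2" "c = g $ 2 $ 1" "d = g $ 2 $ 2"
  have u: "g ** (\<chi> i j. cnj (g $ j $ i)) = mat 1" and dt: "a * d - b * c = 1"
    using assms by (auto simp: SU2_def det_2 abcd)
  have e: "(g ** (\<chi> i j. cnj (g $ j $ i))) $ i $ j = mat 1 $ i $ j" for i j
    by (simp only: u)
  have 1: "a * cnj a + b * cnj b = 1" and 2: "a * cnj c + b * cnj d = 0"
    and 3: "c * cnj a + d * cnj b = 0" and 4: "c * cnj c + d * cnj d = 1"
    using e[of 1 1] e[of 1 2] e[of 2 1] e[of 2 2]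
    by (simp_all add: matrix_matrix_mult_def sum_2 mat_def abcd)
  have "b = - cnj c"
    using 2 4 dt by algebra
  moreover have "d = cnj a"
    using 1 3 dt by algebra
  ultimately show "g $ 1 $ 2 = - cnj (g $ 2 $ 1)" "g $ 2 $ 2 = cnj (g $ 1 $ 1)"
    by (simp_all add: abcd)
qed

lemma weights_eq:
  assumes "l = real n / 2"
  shows "weights l = (\<lambda>k. real k - l) ` {..n}"
proof (intro equalityI subsetI)
  fix m assume m: "m \<in> weights l"
  then obtain k where k: "l + m = real k"
    by (auto simp: weights_def elim: Nats_cases)
  have "k \<le> n"
    using m k assms by (simp add: weights_def)
  then show "m \<in> (\<lambda>k. real k - l) ` {..n}"
    using k by (intro image_eqI[of _ _ k]) auto
next
  fix m assume "m \<in> (\<lambda>k. real k - l) ` {..n}"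
  then obtain k where k: "k \<le> n" "l + m = real k" by auto
  then have "l + m \<in> \<nat>" by simp
  moreover have "0 \<le> l + m" "l + m \<le> 2 * l"
    using k assms by simp_all
  ultimately show "m \<in> weights l"
    by (simp add: weights_def)
qed

lemma finite_weights: "l \<in> half_nats \<Longrightarrow> finite (weights l)"
proof -
  assume "l \<in> half_nats"
  then obtain n where "2 * l = real n"
    by (auto simp: half_nats_def elim: Nats_cases)
  then show ?thesis by (simp add: weights_eq[of l n])
qed

lemma wigner_psi_nat:
  assumes "l = real n / 2" "k \<le> n"
  shows "wigner_psi l (real k - l) z0 z1 = of_real (sqrt (real (n choose k))) * z0 ^ k * z1 ^ (n - k)"
proof -
  have "2 * l = real n"
    using assms by simp
  then have "nat \<lfloor>2 * l\<rfloor> = n"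
    by (simp only: floor_of_nat nat_int)
  moreover have "nat \<lfloor>l + (real k - l)\<rfloor> = k"
    by simp
  moreover have "l - (real k - l) = real (n - k)"
    using assms by (simp add: of_nat_diff)
  then have "nat \<lfloor>l - (real k - l)\<rfloor> = n - k"
    by (metis floor_of_nat nat_int)
  ultimately show ?thesis
    by (simp only: wigner_psi_def)
qed

lemma homogeneous_mult:
  fixes e :: "nat \<Rightarrow> complex"
  shows "\<exists>f. \<forall>z0 z1. (a * z0 + b * z1) * (\<Sum>k\<le>n. e k * z0 ^ k * z1 ^ (n - k)) =
                     (\<Sum>k\<le>Suc n. f k * z0 ^ k * z1 ^ (Suc n - k))"
proof (intro exI allI)
  fix z0 z1
  define f where "f k = (if k = 0 then 0 else a * e (k - 1)) + (if k \<le> n then b * e k else 0)" for k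
  have A: "(\<Sum>k\<le>Suc n. (if k = 0 then 0 else a * e (k - 1)) * z0 ^ k * z1 ^ (Suc n - k)) =
      a * z0 * (\<Sum>k\<le>n. e k * z0 ^ k * z1 ^ (n - k))"
    by (subst sum.atMost_Suc_shift) (simp add: sum_distrib_left mult_ac)
  have B: "(\<Sum>k\<le>Suc n. (if k \<le> n then b * e k else 0) * z0 ^ k * z1 ^ (Suc n - k)) =
      b * z1 * (\<Sum>k\<le>n. e k * z0 ^ k * z1 ^ (n - k))"
    by (simp add: sum_distrib_left mult_ac Suc_diff_le)
  show "(a * z0 + b * z1) * (\<Sum>k\<le>n. e k * z0 ^ k * z1 ^ (n - k)) =
      (\<Sum>k\<le>Suc n. f k * z0 ^ k * z1 ^ (Suc n - k))"
    unfolding f_def distrib_right sum.distrib A B by simp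
qed

lemma homogeneous_product:
  fixes a b c d :: complex
  shows "\<exists>e. \<forall>z0 z1. (a * z0 + b * z1) ^ p * (c * z0 + d * z1) ^ q =
                     (\<Sum>k\<le>p + q. e k * z0 ^ k * z1 ^ (p + q - k))"
proof (induction p)
  case 0
  show ?case
  proof (induction q)
    case 0
    show ?case by (intro exI[of _ "\<lambda>_. 1"]) simp
  next
    case (Suc q)
    then obtain e where e: "\<And>z0 z1. (a * z0 + b * z1) ^ 0 * (c * z0 + d * z1) ^ q =
                     (\<Sum>k\<le>0 + q. e k * z0 ^ k * z1 ^ (0 + q - k))" by blast
    obtain f where f: "\<And>z0 z1. (c * z0 + d * z1) * (\<Sum>k\<le>q. e k * z0 ^ k * z1 ^ (q - k)) =
                     (\<Sum>k\<le>Suc q. f k * z0 ^ k * z1 ^ (Suc q - k))"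
      using homogeneous_mult by metis
    show ?case
      using e f by (intro exI[of _ f]) simp
  qed
next
  case (Suc p)
  then obtain e where e: "\<And>z0 z1. (a * z0 + b * z1) ^ p * (c * z0 + d * z1) ^ q =
                   (\<Sum>k\<le>p + q. e k * z0 ^ k * z1 ^ (p + q - k))" by blast
  obtain f where f: "\<And>z0 z1. (a * z0 + b * z1) * (\<Sum>k\<le>p + q. e k * z0 ^ k * z1 ^ (p + q - k)) =
                   (\<Sum>k\<le>Suc (p + q). f k * z0 ^ k * z1 ^ (Suc (p + q) - k))"
    using homogeneous_mult by metis
  show ?case
    using e f by (intro exI[of _ f]) (simp add: mult.assoc)
qed

lemma sum_weights_psi:
  assumes "l = real n / 2"
  shows "(\<Sum>m\<in>weights l. wigner_psi l m z0 z1 * c m) =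
    (\<Sum>k\<le>n. (of_real (sqrt (real (n choose k))) * c (real k - l)) * z0 ^ k * z1 ^ (n - k))"
  unfolding weights_eq[OF assms]
  by (subst sum.reindex) (auto simp: inj_on_def wigner_psi_nat[OF assms] mult_ac intro!: sum.cong)

lemma wigner_column_ex1:
  assumes "l \<in> half_nats" "s \<in> weights l"
  shows "\<exists>!c. c \<in> extensional (weights l) \<and>
        (\<forall>z0 z1. (\<Sum>m\<in>weights l. wigner_psi l m z0 z1 * c m) =
           wigner_psi l s (a0 * z0 + a1 * z1) (b0 * z0 + b1 * z1))"
proof -
  obtain n where n': "2 * l = real n"
    using assms(1) by (auto simp: half_nats_def elim: Nats_cases)
  then have n: "l = real n / 2" by simp
  obtain j where j: "j \<le> n" "s = real j - l"
    using assms(2) by (auto simp: weights_eq[OF n])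
  have nz: "complex_of_real (sqrt (real (n choose k))) \<noteq> 0" if "k \<le> n" for k
    using that by simp
  obtain e where e: "\<And>z0 z1. (a0 * z0 + a1 * z1) ^ j * (b0 * z0 + b1 * z1) ^ (n - j) =
                     (\<Sum>k\<le>n. e k * z0 ^ k * z1 ^ (n - k))"
    using homogeneous_product[of a0 a1 j b0 b1 "n - j"] j by auto
  show ?thesis
  proof (rule ex_ex1I)
    define c where "c = (\<lambda>m\<in>weights l. of_real (sqrt (real (n choose j))) * e (nat \<lfloor>l + m\<rfloor>) /
        complex_of_real (sqrt (real (n choose nat \<lfloor>l + m\<rfloor>))))"
    have "(\<Sum>m\<in>weights l. wigner_psi l m z0 z1 * c m) =
           wigner_psi l s (a0 * z0 + a1 * z1) (b0 * z0 + b1 * z1)" for z0 z1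
    proof -
      have "(\<Sum>m\<in>weights l. wigner_psi l m z0 z1 * c m) =
          (\<Sum>k\<le>n. of_real (sqrt (real (n choose j))) * (e k * z0 ^ k * z1 ^ (n - k)))"
        unfolding sum_weights_psi[OF n]
        by (intro sum.cong) (use nz in \<open>auto simp: c_def weights_eq[OF n]\<close>)
      also have "\<dots> = wigner_psi l s (a0 * z0 + a1 * z1) (b0 * z0 + b1 * z1)"
        unfolding j(2) wigner_psi_nat[OF n j(1)] sum_distrib_left[symmetric] e[symmetric]
        by simp
      finally show ?thesis .
    qed
    then show "\<exists>c. c \<in> extensional (weights l) \<and>
        (\<forall>z0 z1. (\<Sum>m\<in>weights l. wigner_psi l m z0 z1 * c m) =
           wigner_psi l s (a0 * z0 + a1 * z1) (b0 * z0 + b1 * z1))"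
      by (intro exI[of _ c]) (simp add: c_def)
  next
    fix c d
    assume c: "c \<in> extensional (weights l) \<and>
        (\<forall>z0 z1. (\<Sum>m\<in>weights l. wigner_psi l m z0 z1 * c m) =
           wigner_psi l s (a0 * z0 + a1 * z1) (b0 * z0 + b1 * z1))"
      and d: "d \<in> extensional (weights l) \<and>
        (\<forall>z0 z1. (\<Sum>m\<in>weights l. wigner_psi l m z0 z1 * d m) =
           wigner_psi l s (a0 * z0 + a1 * z1) (b0 * z0 + b1 * z1))"
    have "(\<Sum>m\<in>weights l. wigner_psi l m z 1 * c m) = (\<Sum>m\<in>weights l. wigner_psi l m z 1 * d m)" for z
      using c d by simp
    then have "\<forall>z. (\<Sum>k\<le>n. (of_real (sqrt (real (n choose k))) * c (real k - l)) * z ^ k) =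
        (\<Sum>k\<le>n. (of_real (sqrt (real (n choose k))) * d (real k - l)) * z ^ k)"
      unfolding sum_weights_psi[OF n] by simp
    then have "\<forall>k\<le>n. complex_of_real (sqrt (real (n choose k))) * c (real k - l) =
        of_real (sqrt (real (n choose k))) * d (real k - l)"
      by (subst (asm) polyfun_eq_coeffs)
    then have "c m = d m" if "m \<in> weights l" for m
      using that nz by (auto simp: weights_eq[OF n])
    then show "c = d"
      using c d by (blast intro: extensionalityI)
  qed
qed

lemma wigner_D_identity:
  assumes "l \<in> half_nats" "s \<in> weights l"
  shows "(\<Sum>m\<in>weights l. wigner_psi l m z0 z1 * wigner_D l g m s) =
           wigner_psi l s (cnj (g $ 1 $ 1) * z0 + cnj (g $ 2 $ 1) * z1)
                          (- (g $ 2 $ 1) * z0 + g $ 1 $ 1 * z1)"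
  using theI'[OF wigner_column_ex1[OF assms, of "cnj (g $ 1 $ 1)" "cnj (g $ 2 $ 1)"
      "- (g $ 2 $ 1)" "g $ 1 $ 1"]]
  unfolding wigner_D_def by blast

lemma wigner_D_unique:
  assumes "l \<in> half_nats" "s \<in> weights l" "m \<in> weights l"
    and "\<And>z0 z1. (\<Sum>m\<in>weights l. wigner_psi l m z0 z1 * c m) =
           wigner_psi l s (cnj (g $ 1 $ 1) * z0 + cnj (g $ 2 $ 1) * z1)
                          (- (g $ 2 $ 1) * z0 + g $ 1 $ 1 * z1)"
  shows "wigner_D l g m s = c m"
proof -
  have "(\<Sum>m\<in>weights l. wigner_psi l m z0 z1 * restrict c (weights l) m) =
      (\<Sum>m\<in>weights l. wigner_psi l m z0 z1 * c m)" for z0 z1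
    by (intro sum.cong) auto
  then have "wigner_D l g m s = restrict c (weights l) m"
    unfolding wigner_D_def
    using assms(4) by (subst the1_equality[OF wigner_column_ex1[OF assms(1,2)], of "restrict c (weights l)"]) auto
  then show ?thesis
    using assms(3) by simp
qed

end

theory Submission
  imports Defs "HOL-Computational_Algebra.Polynomial"
begin

text \<open>By left invariance and independence, \<open>(g \<gamma>, \<V>)\<close> and \<open>(\<gamma>, \<V>)\<close> have the same law for every fixed
  \<open>g\<close>. Since \<open>D\<close> is multiplicative, \<open>D(g) D(\<gamma>) \<V> = D(g \<gamma>) \<V>\<close> is then distributed like \<open>D(\<gamma>) \<V>\<close>, so a law
  (or moment) that agrees with that of \<open>D(\<gamma>) \<V>\<close> is invariant. Conversely, if the law of \<open>D(g) \<V>\<close> does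
  not depend on \<open>g\<close>, integrating over \<open>g\<close> gives the law of \<open>D(\<gamma>) \<V>\<close>. Moments of order two reduce to
  means by passing to tensor squares.\<close>

section \<open>Averaging over an independent left-invariant element\<close>

text \<open>Abstract setting for the averaging arguments. Haar measure enters through
  \<open>invariant\<close>, and the target space \<open>S\<close> is left free, so that one random
  element \<open>Y\<close> can carry a whole collection of vectors.\<close>

locale independent_left_invariant = prob_space M
  for M :: "'w measure" +
  fixes G :: "'g measure" and mult :: "'g \<Rightarrow> 'g \<Rightarrow> 'g" and \<gamma> :: "'w \<Rightarrow> 'g"
    and S :: "'s measure" and Y :: "'w \<Rightarrow> 's"
  assumes \<gamma> [measurable]: "\<gamma> \<in> measurable M G"
    and Y [measurable]: "Y \<in> measurable M S"
    and mult: "\<And>g. g \<in> space G \<Longrightarrow> mult g \<in> measurable G G"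
    and invariant: "\<And>g. g \<in> space G \<Longrightarrow> distr (distr M G \<gamma>) G (mult g) = distr M G \<gamma>"
    and indep: "indep_set {\<gamma> -` A \<inter> space M | A. A \<in> sets G} {Y -` B \<inter> space M | B. B \<in> sets S}"
begin

text \<open>Independence is the product formula on rectangles, which characterises the product of
  the two sigma-finite laws.\<close>

lemma joint_distr:
  "distr M (G \<Otimes>\<^sub>M S) (\<lambda>\<omega>. (\<gamma> \<omega>, Y \<omega>)) = distr M G \<gamma> \<Otimes>\<^sub>M distr M S Y"
proof -
  interpret G: prob_space "distr M G \<gamma>" by (rule prob_space_distr) simp
  interpret S: prob_space "distr M S Y" by (rule prob_space_distr) simp
  show ?thesis
  proof (rule pair_measure_eqI[symmetric])
    fix A B assume "A \<in> sets (distr M G \<gamma>)" "B \<in> sets (distr M S Y)"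
    then have [measurable]: "A \<in> sets G" "B \<in> sets S" by auto
    have "(\<lambda>\<omega>. (\<gamma> \<omega>, Y \<omega>)) -` (A \<times> B) \<inter> space M = (\<gamma> -` A \<inter> space M) \<inter> (Y -` B \<inter> space M)"
      by auto
    moreover have "prob ((\<gamma> -` A \<inter> space M) \<inter> (Y -` B \<inter> space M)) =
        prob (\<gamma> -` A \<inter> space M) * prob (Y -` B \<inter> space M)"
      by (rule indep_setD[OF indep]) (auto intro!: exI[of _ A] exI[of _ B])
    ultimately show "emeasure (distr M G \<gamma>) A * emeasure (distr M S Y) B =
        emeasure (distr M (G \<Otimes>\<^sub>M S) (\<lambda>\<omega>. (\<gamma> \<omega>, Y \<omega>))) (A \<times> B)"
      by (simp add: emeasure_distr emeasure_eq_measure ennreal_mult)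
  qed (simp_all add: G.sigma_finite_measure S.sigma_finite_measure cong: sets_pair_measure_cong)
qed

text \<open>The joint law is a product, and translation moves only its first factor, which is left
  invariant.\<close>

lemma translated_joint_distr:
  assumes g: "g \<in> space G"
  shows "distr M (G \<Otimes>\<^sub>M S) (\<lambda>\<omega>. (mult g (\<gamma> \<omega>), Y \<omega>)) = distr M (G \<Otimes>\<^sub>M S) (\<lambda>\<omega>. (\<gamma> \<omega>, Y \<omega>))"
proof -
  note [measurable] = mult[OF g]
  interpret G: prob_space "distr M G \<gamma>" by (rule prob_space_distr) simp
  interpret S: prob_space "distr M S Y" by (rule prob_space_distr) simp
  have "distr M (G \<Otimes>\<^sub>M S) (\<lambda>\<omega>. (mult g (\<gamma> \<omega>), Y \<omega>)) =
      distr (distr M (G \<Otimes>\<^sub>M S) (\<lambda>\<omega>. (\<gamma> \<omega>, Y \<omega>))) (G \<Otimes>\<^sub>M S) (\<lambda>(h, y). (mult g h, y))"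
    by (subst distr_distr) (simp_all add: comp_def)
  \<comment> \<open>\<open>id\<close> on the second coordinate puts the map in the form that
    \<open>pair_measure_distr\<close> handles.\<close>
  also have "\<dots> = distr (distr M G \<gamma> \<Otimes>\<^sub>M distr M S Y) (G \<Otimes>\<^sub>M S) (\<lambda>(h, y). (mult g h, id y))"
    by (simp add: joint_distr)
  also have "\<dots> = distr (distr M G \<gamma>) G (mult g) \<Otimes>\<^sub>M distr (distr M S Y) S id"
    by (subst pair_measure_distr)
      (simp_all add: invariant g distr_distr comp_def S.sigma_finite_measure)
  finally show ?thesis
    unfolding invariant[OF g] joint_distr by (simp add: distr_distr comp_def)
qed

text \<open>One direction is Tonelli: with \<open>g\<close> fixed first, all sections have the same
  measure. In the other, \<open>act g\<close> is absorbed into \<open>\<gamma>\<close> by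
  \<open>act_mult\<close> and then removed by left invariance.\<close>

lemma distr_invariant_iff:
  assumes act: "(\<lambda>(g, y). act g y) \<in> measurable (G \<Otimes>\<^sub>M S) S"
    and act_mult: "\<And>g h y. g \<in> space G \<Longrightarrow> h \<in> space G \<Longrightarrow> y \<in> space S \<Longrightarrow>
      act (mult g h) y = act g (act h y)"
  shows "(\<forall>g\<in>space G. distr M S Y = distr M S (\<lambda>\<omega>. act g (Y \<omega>))) \<longleftrightarrow>
    distr M S Y = distr M S (\<lambda>\<omega>. act (\<gamma> \<omega>) (Y \<omega>))"
proof -
  note act' [measurable] = act[unfolded case_prod_beta']
  have act_g [measurable]: "act g \<in> measurable S S" if "g \<in> space G" for g
    using measurable_compose[OF measurable_Pair1'[OF that] act] by simp
  interpret G: prob_space "distr M G \<gamma>" by (rule prob_space_distr) simp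
  interpret S: prob_space "distr M S Y" by (rule prob_space_distr) simp
  have random: "distr M S (\<lambda>\<omega>. act (\<gamma> \<omega>) (Y \<omega>)) =
      distr (distr M G \<gamma> \<Otimes>\<^sub>M distr M S Y) S (\<lambda>(g, y). act g y)"
    by (simp add: joint_distr[symmetric] distr_distr act comp_def)
  show ?thesis
  proof
    assume inv: "\<forall>g\<in>space G. distr M S Y = distr M S (\<lambda>\<omega>. act g (Y \<omega>))"
    show "distr M S Y = distr M S (\<lambda>\<omega>. act (\<gamma> \<omega>) (Y \<omega>))"
    proof (rule measure_eqI)
      fix B assume "B \<in> sets (distr M S Y)"
      then have [measurable]: "B \<in> sets S" by simp
      let ?C = "(\<lambda>(g, y). act g y) -` B \<inter> space (G \<Otimes>\<^sub>M S)"
      have C: "?C \<in> sets (G \<Otimes>\<^sub>M S)"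
        using act by (rule measurable_sets) simp
      \<comment> \<open>The section of \<open>?C\<close> over \<open>g\<close> is the preimage of
        \<open>B\<close> under \<open>act g\<close>, so \<open>inv\<close> makes its measure
        independent of \<open>g\<close>.\<close>
      have "emeasure (distr M S Y) (Pair g -` ?C) = emeasure (distr M S Y) B" if g: "g \<in> space G" for g
      proof -
        have "Pair g -` ?C = act g -` B \<inter> space S"
          using g by (auto simp: space_pair_measure)
        then have "emeasure (distr M S Y) (Pair g -` ?C) = emeasure (distr (distr M S Y) S (act g)) B"
          using g by (simp add: emeasure_distr)
        also have "distr (distr M S Y) S (act g) = distr M S (\<lambda>\<omega>. act g (Y \<omega>))"
          using g by (simp add: distr_distr comp_def)
        also have "\<dots> = distr M S Y"
          using inv g by simp
        finally show ?thesis .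
      qed
      then have "(\<integral>\<^sup>+g. emeasure (distr M S Y) (Pair g -` ?C) \<partial>distr M G \<gamma>) =
          (\<integral>\<^sup>+g. emeasure (distr M S Y) B \<partial>distr M G \<gamma>)"
        by (intro nn_integral_cong) simp
      then have "emeasure (distr M G \<gamma> \<Otimes>\<^sub>M distr M S Y) ?C = emeasure (distr M S Y) B"
        using C by (subst S.emeasure_pair_measure_alt)
          (simp_all add: G.emeasure_space_1[simplified] cong: sets_pair_measure_cong)
      then show "emeasure (distr M S Y) B = emeasure (distr M S (\<lambda>\<omega>. act (\<gamma> \<omega>) (Y \<omega>))) B"
        using act unfolding random by (subst emeasure_distr)
          (simp_all add: space_pair_measure cong: measurable_cong_sets sets_pair_measure_cong)
    qed simp
  next
    assume inv: "distr M S Y = distr M S (\<lambda>\<omega>. act (\<gamma> \<omega>) (Y \<omega>))"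
    show "\<forall>g\<in>space G. distr M S Y = distr M S (\<lambda>\<omega>. act g (Y \<omega>))"
    proof
      fix g assume g: "g \<in> space G"
      note [measurable] = act_g[OF g] mult[OF g]
      have "distr M S (\<lambda>\<omega>. act g (Y \<omega>)) = distr (distr M S Y) S (act g)"
        by (simp add: distr_distr comp_def)
      \<comment> \<open>Here \<open>inv\<close> replaces the law of \<open>Y\<close> by that of
        \<open>act (\<gamma> \<omega>) (Y \<omega>)\<close> underneath \<open>act g\<close>.\<close>
      also have "\<dots> = distr M S (\<lambda>\<omega>. act g (act (\<gamma> \<omega>) (Y \<omega>)))"
        unfolding inv by (subst distr_distr)
          (auto simp: comp_def intro!: measurable_compose[OF measurable_Pair[OF \<gamma> Y] act, simplified])
      also have "\<dots> = distr M S (\<lambda>\<omega>. act (mult g (\<gamma> \<omega>)) (Y \<omega>))"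
        using g act_mult measurable_space[OF \<gamma>] measurable_space[OF Y]
        by (intro distr_cong) simp_all
      also have "\<dots> = distr (distr M (G \<Otimes>\<^sub>M S) (\<lambda>\<omega>. (mult g (\<gamma> \<omega>), Y \<omega>))) S (\<lambda>(g, y). act g y)"
        using act by (subst distr_distr) (simp_all add: comp_def)
      also have "\<dots> = distr M S (\<lambda>\<omega>. act (\<gamma> \<omega>) (Y \<omega>))"
        unfolding translated_joint_distr[OF g] joint_distr random ..
      finally show "distr M S Y = distr M S (\<lambda>\<omega>. act g (Y \<omega>))"
        using inv by simp
    qed
  qed
qed

text \<open>Writing \<open>e\<close> for the mean of \<open>Z\<close> and \<open>A\<close> for the mean of \<open>T \<gamma>\<close>, the condition on the right
  is \<open>e = A e\<close>, and left invariance gives \<open>T g A = A\<close>.\<close>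

lemma mean_invariant_iff:
  fixes Z :: "'s \<Rightarrow> 'k \<Rightarrow> complex" and T :: "'g \<Rightarrow> 'k \<Rightarrow> 'k \<Rightarrow> complex"
  assumes K: "finite K"
    and Z [measurable]: "\<And>k. k \<in> K \<Longrightarrow> (\<lambda>y. Z y k) \<in> borel_measurable S"
    and int_Z: "\<And>k. k \<in> K \<Longrightarrow> integrable M (\<lambda>\<omega>. Z (Y \<omega>) k)"
    and T [measurable]: "\<And>j k. j \<in> K \<Longrightarrow> k \<in> K \<Longrightarrow> (\<lambda>g. T g j k) \<in> borel_measurable G"
    and bound: "\<And>g j k. g \<in> space G \<Longrightarrow> j \<in> K \<Longrightarrow> k \<in> K \<Longrightarrow> cmod (T g j k) \<le> C"
    and T_mult: "\<And>g h i k. g \<in> space G \<Longrightarrow> h \<in> space G \<Longrightarrow> i \<in> K \<Longrightarrow> k \<in> K \<Longrightarrow>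
      T (mult g h) i k = (\<Sum>j\<in>K. T g i j * T h j k)"
  shows "(\<forall>g\<in>space G. \<forall>i\<in>K. (LINT \<omega>|M. Z (Y \<omega>) i) = (LINT \<omega>|M. (\<Sum>k\<in>K. T g i k * Z (Y \<omega>) k))) \<longleftrightarrow>
    (\<forall>i\<in>K. (LINT \<omega>|M. Z (Y \<omega>) i) = (LINT \<omega>|M. (\<Sum>k\<in>K. T (\<gamma> \<omega>) i k * Z (Y \<omega>) k)))"
proof -
  define e where "e k = (LINT \<omega>|M. Z (Y \<omega>) k)" for k
  define A where "A i k = (LINT \<omega>|M. T (\<gamma> \<omega>) i k)" for i k
  have \<gamma>_space: "\<gamma> \<omega> \<in> space G" if "\<omega> \<in> space M" for \<omega>
    using measurable_space[OF \<gamma> that] .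
  have int_T: "integrable M (\<lambda>\<omega>. T (\<gamma> \<omega>) i k)" if "i \<in> K" "k \<in> K" for i k
    using that bound \<gamma>_space by (intro integrable_const_bound[of _ C]) auto
  have fixed: "(LINT \<omega>|M. (\<Sum>k\<in>K. T g i k * Z (Y \<omega>) k)) = (\<Sum>k\<in>K. T g i k * e k)" for g i
    unfolding e_def using int_Z by (subst Bochner_Integration.integral_sum) auto
  \<comment> \<open>Independence is inherited because these variables generate coarser
    sigma-algebras than \<open>\<gamma>\<close> and \<open>Y\<close>.\<close>
  have indep_TZ: "indep_var borel (\<lambda>\<omega>. T (\<gamma> \<omega>) i k) borel (\<lambda>\<omega>. Z (Y \<omega>) k)"
    if ik: "i \<in> K" "k \<in> K" for i k
  proof -
    have "{(\<lambda>\<omega>. T (\<gamma> \<omega>) i k) -` A \<inter> space M | A. A \<in> sets borel} \<subseteq> {\<gamma> -` A \<inter> space M | A. A \<in> sets G}"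
    proof clarify
      fix A :: "complex set" assume "A \<in> sets borel"
      then have "(\<lambda>g. T g i k) -` A \<inter> space G \<in> sets G"
        using ik by (intro measurable_sets[OF T])
      then show "\<exists>B. (\<lambda>\<omega>. T (\<gamma> \<omega>) i k) -` A \<inter> space M = \<gamma> -` B \<inter> space M \<and> B \<in> sets G"
        using \<gamma>_space by (intro exI[of _ "(\<lambda>g. T g i k) -` A \<inter> space G"]) auto
    qed
    moreover have "{(\<lambda>\<omega>. Z (Y \<omega>) k) -` A \<inter> space M | A. A \<in> sets borel} \<subseteq> {Y -` B \<inter> space M | B. B \<in> sets S}"
    proof clarify
      fix A :: "complex set" assume "A \<in> sets borel"
      then have "(\<lambda>y. Z y k) -` A \<inter> space S \<in> sets S"
        using ik by (intro measurable_sets[OF Z])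
      then show "\<exists>B. (\<lambda>\<omega>. Z (Y \<omega>) k) -` A \<inter> space M = Y -` B \<inter> space M \<and> B \<in> sets S"
        using measurable_space[OF Y] by (intro exI[of _ "(\<lambda>y. Z y k) -` A \<inter> space S"]) auto
    qed
    ultimately show ?thesis
      unfolding indep_var_def indep_vars_def2 using ik
      by (intro conjI indep_sets_mono_sets[OF indep[unfolded indep_set_def]])
        (auto split: bool.split)
  qed
  have random: "(LINT \<omega>|M. (\<Sum>k\<in>K. T (\<gamma> \<omega>) i k * Z (Y \<omega>) k)) = (\<Sum>k\<in>K. A i k * e k)" if "i \<in> K" for i
    using indep_TZ int_T int_Z that unfolding e_def A_def
    by (subst Bochner_Integration.integral_sum)
      (auto intro!: indep_var_integrable indep_var_lebesgue_integral sum.cong)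
  \<comment> \<open>Pulling \<open>T g\<close> into the integral and applying \<open>T_mult\<close>
    gives the mean of \<open>T (mult g (\<gamma> \<omega>)) i k\<close>, from which left invariance
    removes \<open>g\<close>.\<close>
  have TA: "(\<Sum>j\<in>K. T g i j * A j k) = A i k" if g: "g \<in> space G" and ik: "i \<in> K" "k \<in> K" for g i k
  proof -
    note [measurable] = mult[OF g]
    have "(\<Sum>j\<in>K. T g i j * A j k) = (LINT \<omega>|M. (\<Sum>j\<in>K. T g i j * T (\<gamma> \<omega>) j k))"
      unfolding A_def using int_T ik by (subst Bochner_Integration.integral_sum) auto
    also have "\<dots> = (LINT \<omega>|M. T (mult g (\<gamma> \<omega>)) i k)"
      using T_mult g ik \<gamma>_space by (intro Bochner_Integration.integral_cong) auto
    also have "\<dots> = (LINT h|distr (distr M G \<gamma>) G (mult g). T h i k)"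
      using ik by (subst distr_distr) (simp_all add: integral_distr comp_def)
    also have "\<dots> = A i k"
      unfolding invariant[OF g] A_def using ik by (simp add: integral_distr)
    finally show ?thesis .
  qed
  show ?thesis
    unfolding fixed
  proof
    assume inv: "\<forall>g\<in>space G. \<forall>i\<in>K. (LINT \<omega>|M. Z (Y \<omega>) i) = (\<Sum>k\<in>K. T g i k * e k)"
    show "\<forall>i\<in>K. (LINT \<omega>|M. Z (Y \<omega>) i) = (LINT \<omega>|M. (\<Sum>k\<in>K. T (\<gamma> \<omega>) i k * Z (Y \<omega>) k))"
    proof
      fix i assume i: "i \<in> K"
      have "(\<Sum>k\<in>K. A i k * e k) = (LINT \<omega>|M. (\<Sum>k\<in>K. T (\<gamma> \<omega>) i k * e k))"
        unfolding A_def using int_T i by (subst Bochner_Integration.integral_sum) auto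
      \<comment> \<open>\<open>inv\<close> applies at \<open>g = \<gamma> \<omega>\<close> for every
        outcome, so the integrand is constantly \<open>e i\<close>.\<close>
      also have "\<dots> = (LINT \<omega>|M. e i)"
        using inv i \<gamma>_space unfolding e_def[symmetric]
        by (intro Bochner_Integration.integral_cong) (metis refl)+
      finally show "(LINT \<omega>|M. Z (Y \<omega>) i) = (LINT \<omega>|M. (\<Sum>k\<in>K. T (\<gamma> \<omega>) i k * Z (Y \<omega>) k))"
        using random[OF i] by (simp add: prob_space e_def)
    qed
  next
    assume "\<forall>i\<in>K. (LINT \<omega>|M. Z (Y \<omega>) i) = (LINT \<omega>|M. (\<Sum>k\<in>K. T (\<gamma> \<omega>) i k * Z (Y \<omega>) k))"
    then have Ae: "e i = (\<Sum>k\<in>K. A i k * e k)" if "i \<in> K" for i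
      using that random by (simp add: e_def)
    show "\<forall>g\<in>space G. \<forall>i\<in>K. (LINT \<omega>|M. Z (Y \<omega>) i) = (\<Sum>k\<in>K. T g i k * e k)"
    proof (intro ballI)
      fix g i assume g: "g \<in> space G" and i: "i \<in> K"
      \<comment> \<open>Substitute \<open>e = A e\<close> under \<open>T g\<close> and regroup as
        \<open>(T g A) e\<close>.\<close>
      have "(\<Sum>j\<in>K. T g i j * e j) = (\<Sum>j\<in>K. T g i j * (\<Sum>k\<in>K. A j k * e k))"
        using Ae by (intro sum.cong) auto
      also have "\<dots> = (\<Sum>k\<in>K. \<Sum>j\<in>K. T g i j * A j k * e k)"
        by (subst sum.swap) (simp add: sum_distrib_left mult.assoc)
      also have "\<dots> = (\<Sum>k\<in>K. A i k * e k)"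
        using TA g i by (intro sum.cong) (auto simp: sum_distrib_right[symmetric])
      finally show "(LINT \<omega>|M. Z (Y \<omega>) i) = (\<Sum>k\<in>K. T g i k * e k)"
        using Ae[OF i] by (simp add: e_def)
    qed
  qed
qed

end

section \<open>Square integrability and congruence of the moment conditions\<close>

text \<open>The dominating function comes from \<open>2 |x| |z| \<le> |x|^2 + |z|^2\<close>. With
  \<open>Z = 1\<close> on a probability space, square integrability yields integrability.\<close>

lemma square_integrable_mult:
  fixes X Z :: "'w \<Rightarrow> complex"
  assumes [measurable]: "X \<in> borel_measurable M" "Z \<in> borel_measurable M"
    and "integrable M (\<lambda>\<omega>. (cmod (X \<omega>))\<^sup>2)" "integrable M (\<lambda>\<omega>. (cmod (Z \<omega>))\<^sup>2)"
  shows "integrable M (\<lambda>\<omega>. X \<omega> * Z \<omega>)"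
proof (rule Bochner_Integration.integrable_bound)
  show "integrable M (\<lambda>\<omega>. (cmod (X \<omega>))\<^sup>2 + (cmod (Z \<omega>))\<^sup>2)"
    using assms by simp
  have "cmod x * cmod z \<le> (cmod x)\<^sup>2 + (cmod z)\<^sup>2" for x z :: complex
    using sum_squares_bound[of "cmod x" "cmod z"] mult_nonneg_nonneg[of "cmod x" "cmod z"]
    by (simp add: mult.assoc del: mult_nonneg_nonneg)
  then show "AE \<omega> in M. norm (X \<omega> * Z \<omega>) \<le> norm ((cmod (X \<omega>))\<^sup>2 + (cmod (Z \<omega>))\<^sup>2)"
    by (simp add: norm_mult)
qed simp

text \<open>\<open>T\<close> may depend on the outcome, so that fixed matrices and
  \<open>R (\<gamma> \<omega>)\<close> are both covered. The domination combines the uniform bound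
  on the entries with the fact that the square of a sum over \<open>J\<close> is at most
  \<open>card J\<close> times the sum of squares.\<close>

lemma finite_second_moments_linear_image:
  assumes J: "finite J" and X: "finite_second_moments M J X"
    and T [measurable]: "\<And>a b. a \<in> J \<Longrightarrow> b \<in> J \<Longrightarrow> (\<lambda>\<omega>. T \<omega> a b) \<in> borel_measurable M"
    and bound: "\<And>\<omega> a b. \<omega> \<in> space M \<Longrightarrow> a \<in> J \<Longrightarrow> b \<in> J \<Longrightarrow> cmod (T \<omega> a b) \<le> C"
  shows "finite_second_moments M J (\<lambda>\<omega> a. \<Sum>b\<in>J. T \<omega> a b * X \<omega> b)"
  unfolding finite_second_moments_def
proof (intro ballI conjI)
  have X_meas [measurable]: "(\<lambda>\<omega>. X \<omega> b) \<in> borel_measurable M" if "b \<in> J" for b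
    using X that by (auto simp: finite_second_moments_def)
  fix a assume a: "a \<in> J"
  show meas: "(\<lambda>\<omega>. \<Sum>b\<in>J. T \<omega> a b * X \<omega> b) \<in> borel_measurable M"
    using a by measurable
  show "integrable M (\<lambda>\<omega>. (cmod (\<Sum>b\<in>J. T \<omega> a b * X \<omega> b))\<^sup>2)"
  proof (rule Bochner_Integration.integrable_bound)
    show "integrable M (\<lambda>\<omega>. (\<Sum>b\<in>J. C\<^sup>2 * (cmod (X \<omega> b))\<^sup>2) * card J)"
      using X by (auto simp: finite_second_moments_def)
    show "AE \<omega> in M. norm ((cmod (\<Sum>b\<in>J. T \<omega> a b * X \<omega> b))\<^sup>2) \<le>
        norm ((\<Sum>b\<in>J. C\<^sup>2 * (cmod (X \<omega> b))\<^sup>2) * card J)"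
    proof (rule AE_I2)
      fix \<omega> assume \<omega>: "\<omega> \<in> space M"
      have "(cmod (\<Sum>b\<in>J. T \<omega> a b * X \<omega> b))\<^sup>2 \<le> (\<Sum>b\<in>J. cmod (T \<omega> a b * X \<omega> b))\<^sup>2"
        by (intro power_mono norm_sum) simp
      also have "\<dots> \<le> (\<Sum>b\<in>J. (cmod (T \<omega> a b * X \<omega> b))\<^sup>2) * card J"
        by (rule sum_squared_le_sum_of_squares)
      also have "\<dots> \<le> (\<Sum>b\<in>J. C\<^sup>2 * (cmod (X \<omega> b))\<^sup>2) * card J"
        using bound[OF \<omega> a]
        by (intro mult_right_mono sum_mono) (auto simp: norm_mult power_mult_distrib intro!: mult_right_mono power_mono)
      also have "\<dots> \<le> norm ((\<Sum>b\<in>J. C\<^sup>2 * (cmod (X \<omega> b))\<^sup>2) * card J)"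
        by simp
      finally show "norm ((cmod (\<Sum>b\<in>J. T \<omega> a b * X \<omega> b))\<^sup>2) \<le>
          norm ((\<Sum>b\<in>J. C\<^sup>2 * (cmod (X \<omega> b))\<^sup>2) * card J)"
        by simp
    qed
  qed (use meas in measurable)
qed

text \<open>Agreement is asked only on \<open>J\<close> and \<open>space M\<close>, because the
  matrix sums below are matched with the extensional vectors \<open>wigner_act\<close> on the index
  set only.\<close>

lemma weakly2_equiv_cong:
  assumes "\<And>\<omega> a. \<omega> \<in> space M \<Longrightarrow> a \<in> J \<Longrightarrow> X \<omega> a = X' \<omega> a"
    and "\<And>\<omega> a. \<omega> \<in> space M \<Longrightarrow> a \<in> J \<Longrightarrow> Y \<omega> a = Y' \<omega> a"
  shows "weakly2_equiv M J X Y \<longleftrightarrow> weakly2_equiv M J X' Y'"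
proof -
  have fsm: "finite_second_moments M J Z \<longleftrightarrow> finite_second_moments M J Z'"
    if "\<And>\<omega> a. \<omega> \<in> space M \<Longrightarrow> a \<in> J \<Longrightarrow> Z \<omega> a = Z' \<omega> a" for Z Z' :: "'a \<Rightarrow> 'b \<Rightarrow> complex"
    unfolding finite_second_moments_def using that
    by (intro ball_cong conj_cong measurable_cong Bochner_Integration.integrable_cong) auto
  have lint: "(LINT \<omega>|M. f \<omega>) = (LINT \<omega>|M. f' \<omega>)"
    if "\<And>\<omega>. \<omega> \<in> space M \<Longrightarrow> f \<omega> = f' \<omega>" for f f' :: "'a \<Rightarrow> complex"
    using that by (intro Bochner_Integration.integral_cong) auto
  show ?thesis
    unfolding weakly2_equiv_def
    using assms by (intro conj_cong ball_cong fsm arg_cong2[where f = "(=)"] lint) auto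
qed

section \<open>Two-weak equivalence through tensor squares\<close>

context independent_left_invariant
begin

text \<open>A second moment is a mean in the tensor square of the representation; \<open>f\<close> is conjugation for
  the covariance and the identity for the pseudo-covariance.\<close>

lemma second_moment_invariant_iff:
  fixes X :: "'s \<Rightarrow> 'a \<Rightarrow> complex" and R :: "'g \<Rightarrow> 'a \<Rightarrow> 'a \<Rightarrow> complex" and f :: "complex \<Rightarrow> complex"
  assumes f: "f = cnj \<or> f = (\<lambda>z. z)" and J: "finite J"
    and X [measurable]: "\<And>a. a \<in> J \<Longrightarrow> (\<lambda>y. X y a) \<in> borel_measurable S"
    and fsm: "finite_second_moments M J (\<lambda>\<omega>. X (Y \<omega>))"
    and R [measurable]: "\<And>a b. a \<in> J \<Longrightarrow> b \<in> J \<Longrightarrow> (\<lambda>g. R g a b) \<in> borel_measurable G"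
    and bound: "\<And>g a b. g \<in> space G \<Longrightarrow> a \<in> J \<Longrightarrow> b \<in> J \<Longrightarrow> cmod (R g a b) \<le> C"
    and R_mult: "\<And>g h a c. g \<in> space G \<Longrightarrow> h \<in> space G \<Longrightarrow> a \<in> J \<Longrightarrow> c \<in> J \<Longrightarrow>
      R (mult g h) a c = (\<Sum>b\<in>J. R g a b * R h b c)"
  shows "(\<forall>g\<in>space G. \<forall>a\<in>J. \<forall>b\<in>J. (LINT \<omega>|M. X (Y \<omega>) a * f (X (Y \<omega>) b)) =
      (LINT \<omega>|M. (\<Sum>c\<in>J. R g a c * X (Y \<omega>) c) * f (\<Sum>d\<in>J. R g b d * X (Y \<omega>) d))) \<longleftrightarrow>
    (\<forall>a\<in>J. \<forall>b\<in>J. (LINT \<omega>|M. X (Y \<omega>) a * f (X (Y \<omega>) b)) =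
      (LINT \<omega>|M. (\<Sum>c\<in>J. R (\<gamma> \<omega>) a c * X (Y \<omega>) c) * f (\<Sum>d\<in>J. R (\<gamma> \<omega>) b d * X (Y \<omega>) d)))"
proof -
  \<comment> \<open>\<open>f\<close> is a ring endomorphism preserving the modulus, so applying it
    to the entries of \<open>R\<close> keeps multiplicativity and the bound.\<close>
  have f_mult: "f (x * z) = f x * f z" and norm_f: "cmod (f x) = cmod x" for x z
    using f by auto
  have f_sum: "f (sum h A) = (\<Sum>x\<in>A. f (h x))" for h :: "'a \<Rightarrow> complex" and A
    using f by auto
  have f_meas [measurable]: "f \<in> borel_measurable borel"
    using f by (auto intro: borel_measurable_continuous_onI continuous_intros)
  \<comment> \<open>\<open>T g\<close> is the Kronecker product of \<open>R g\<close> with its image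
    under \<open>f\<close>; it acts on the family \<open>Z y\<close> of products of
    coordinates.\<close>
  define Z where "Z y = (\<lambda>(a, b). X y a * f (X y b))" for y
  define T where "T g = (\<lambda>(a, b) (c, d). R g a c * f (R g b d))" for g
  \<comment> \<open>This factorisation serves twice: for the action of \<open>T g\<close> on
    \<open>Z y\<close> and for the multiplicativity of \<open>T\<close>.\<close>
  have tensor: "(\<Sum>(c, d)\<in>J \<times> J. (u c * f (v d)) * (x c * f (z d))) =
      (\<Sum>c\<in>J. u c * x c) * f (\<Sum>d\<in>J. v d * z d)" for u v x z :: "'a \<Rightarrow> complex"
    by (simp add: f_sum f_mult sum_product sum.cartesian_product mult_ac)
  have TZ: "(\<Sum>k\<in>J \<times> J. T g (a, b) k * Z y k) =
      (\<Sum>c\<in>J. R g a c * X y c) * f (\<Sum>d\<in>J. R g b d * X y d)" for g a b y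
    unfolding tensor[symmetric] T_def Z_def by (intro sum.cong) auto
  have "(\<forall>g\<in>space G. \<forall>i\<in>J \<times> J. (LINT \<omega>|M. Z (Y \<omega>) i) = (LINT \<omega>|M. (\<Sum>k\<in>J \<times> J. T g i k * Z (Y \<omega>) k))) \<longleftrightarrow>
    (\<forall>i\<in>J \<times> J. (LINT \<omega>|M. Z (Y \<omega>) i) = (LINT \<omega>|M. (\<Sum>k\<in>J \<times> J. T (\<gamma> \<omega>) i k * Z (Y \<omega>) k)))"
  proof (rule mean_invariant_iff[where C = "C * C"])
    show "finite (J \<times> J)" using J by simp
    show "(\<lambda>y. Z y k) \<in> borel_measurable S" if "k \<in> J \<times> J" for k
      using that by (auto simp: Z_def)
    show "integrable M (\<lambda>\<omega>. Z (Y \<omega>) k)" if "k \<in> J \<times> J" for k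
      using that fsm unfolding Z_def finite_second_moments_def
      by (auto simp: norm_f intro!: square_integrable_mult)
    show "(\<lambda>g. T g j k) \<in> borel_measurable G" if "j \<in> J \<times> J" "k \<in> J \<times> J" for j k
      using that by (auto simp: T_def)
    show "cmod (T g j k) \<le> C * C" if "g \<in> space G" "j \<in> J \<times> J" "k \<in> J \<times> J" for g j k
      \<comment> \<open>The composed fact is \<open>0 \<le> C\<close>, needed to multiply the two
        estimates.\<close>
      using that bound order.trans[OF norm_ge_zero bound]
      by (auto simp: T_def norm_mult norm_f intro!: mult_mono)
    show "T (mult g h) i k = (\<Sum>j\<in>J \<times> J. T g i j * T h j k)"
      if "g \<in> space G" "h \<in> space G" "i \<in> J \<times> J" "k \<in> J \<times> J" for g h i k
    proof -
      obtain a b c d where ik: "i = (a, b)" "k = (c, d)"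
        by (metis surj_pair)
      have "(\<Sum>j\<in>J \<times> J. T g i j * T h j k) =
          (\<Sum>(p, q)\<in>J \<times> J. (R g a p * f (R g b q)) * (R h p c * f (R h q d)))"
        unfolding ik T_def by (intro sum.cong) auto
      also have "\<dots> = T (mult g h) i k"
        unfolding tensor using that by (simp add: ik T_def R_mult)
      finally show ?thesis ..
    qed
  qed
  moreover have "(\<forall>i\<in>J \<times> J. P i) \<longleftrightarrow> (\<forall>a\<in>J. \<forall>b\<in>J. P (a, b))" for P
    by auto
  ultimately show ?thesis
    unfolding Z_def by (simp only: TZ[unfolded Z_def] prod.case)
qed

text \<open>Mean, covariance and pseudo-covariance each satisfy the equivalence separately, and the
  quantifier over \<open>g\<close> distributes over their conjunction. Finiteness of second moments
  holds on both sides because the matrices are bounded.\<close>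

lemma weakly2_invariant_iff:
  fixes X :: "'s \<Rightarrow> 'a \<Rightarrow> complex" and R :: "'g \<Rightarrow> 'a \<Rightarrow> 'a \<Rightarrow> complex"
  assumes J: "finite J"
    and X [measurable]: "\<And>a. a \<in> J \<Longrightarrow> (\<lambda>y. X y a) \<in> borel_measurable S"
    and fsm: "finite_second_moments M J (\<lambda>\<omega>. X (Y \<omega>))"
    and R [measurable]: "\<And>a b. a \<in> J \<Longrightarrow> b \<in> J \<Longrightarrow> (\<lambda>g. R g a b) \<in> borel_measurable G"
    and bound: "\<And>g a b. g \<in> space G \<Longrightarrow> a \<in> J \<Longrightarrow> b \<in> J \<Longrightarrow> cmod (R g a b) \<le> C"
    and R_mult: "\<And>g h a c. g \<in> space G \<Longrightarrow> h \<in> space G \<Longrightarrow> a \<in> J \<Longrightarrow> c \<in> J \<Longrightarrow>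
      R (mult g h) a c = (\<Sum>b\<in>J. R g a b * R h b c)"
  shows "(\<forall>g\<in>space G. weakly2_equiv M J (\<lambda>\<omega>. X (Y \<omega>)) (\<lambda>\<omega> a. \<Sum>b\<in>J. R g a b * X (Y \<omega>) b)) \<longleftrightarrow>
    weakly2_equiv M J (\<lambda>\<omega>. X (Y \<omega>)) (\<lambda>\<omega> a. \<Sum>b\<in>J. R (\<gamma> \<omega>) a b * X (Y \<omega>) b)"
proof -
  have int_X: "integrable M (\<lambda>\<omega>. X (Y \<omega>) a)" if "a \<in> J" for a
    using fsm that square_integrable_mult[of "\<lambda>\<omega>. X (Y \<omega>) a" M "\<lambda>_. 1"]
    by (auto simp: finite_second_moments_def)
  have fsm_R: "finite_second_moments M J (\<lambda>\<omega> a. \<Sum>b\<in>J. R g a b * X (Y \<omega>) b)" if "g \<in> space G" for g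
    using bound[OF that] by (intro finite_second_moments_linear_image[OF J fsm]) auto
  have fsm_\<gamma>: "finite_second_moments M J (\<lambda>\<omega> a. \<Sum>b\<in>J. R (\<gamma> \<omega>) a b * X (Y \<omega>) b)"
    using bound measurable_space[OF \<gamma>] by (intro finite_second_moments_linear_image[OF J fsm]) auto
  note mean = mean_invariant_iff[OF J X int_X R bound R_mult]
  note second = second_moment_invariant_iff[OF _ J X fsm R bound R_mult]
  note covariance = second[OF disjI1[OF refl]] and pseudo = second[OF disjI2[OF refl]]
  show ?thesis
    unfolding weakly2_equiv_def
    using fsm fsm_R fsm_\<gamma> mean covariance pseudo by (simp add: ball_conj_distrib)
qed

end

section \<open>Wigner matrices as a continuous representation\<close>

lemma SU2_mult:
  assumes "g \<in> SU2" "h \<in> SU2"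
  shows "g ** h \<in> SU2"
proof -
  let ?ct = "\<lambda>g :: complex ^ 2 ^ 2. (\<chi> i j. cnj (g $ j $ i)) :: complex ^ 2 ^ 2"
  have "?ct (g ** h) = ?ct h ** ?ct g"
    by (simp add: vec_eq_iff matrix_matrix_mult_def sum_2 mult.commute)
  then have "(g ** h) ** ?ct (g ** h) = g ** (h ** ?ct h) ** ?ct g"
    by (simp add: matrix_mul_assoc)
  then show ?thesis
    using assms by (simp add: SU2_def det_mul)
qed

text \<open>The two rows of a unitary matrix are unit vectors, so its Euclidean norm is
  \<open>sqrt 2\<close>.\<close>

lemma bounded_SU2: "bounded SU2"
proof (rule boundedI)
  fix g :: "complex ^ 2 ^ 2" assume g: "g \<in> SU2"
  have "(g ** (\<chi> i j. cnj (g $ j $ i))) $ i $ i = 1" for i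
    using g by (simp add: SU2_def mat_def)
  then have "complex_of_real ((cmod (g $ i $ 1))\<^sup>2 + (cmod (g $ i $ 2))\<^sup>2) = 1" for i
    unfolding of_real_add complex_norm_square by (simp add: matrix_matrix_mult_def sum_2)
  then have row: "(cmod (g $ i $ 1))\<^sup>2 + (cmod (g $ i $ 2))\<^sup>2 = 1" for i
    using of_real_eq_1_iff by blast
  then show "norm g \<le> sqrt 2"
    by (simp add: norm_vec_def L2_set_def sum_2)
qed

text \<open>Induction on \<open>p\<close>: multiplying by \<open>b + a X\<close> makes each new
  coefficient a combination of at most two old ones. The factor \<open>P\<close> allows the result
  to be iterated over products of such powers.\<close>

lemma continuous_coeff_linear_power_mult:
  fixes a b :: "'x::topological_space \<Rightarrow> complex"
  assumes "continuous_on A a" "continuous_on A b" "\<And>k. continuous_on A (\<lambda>x. coeff (P x) k)"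
  shows "continuous_on A (\<lambda>x. coeff ([:b x, a x:] ^ p * P x) k)"
proof (induction p arbitrary: k)
  case 0
  show ?case using assms by simp
next
  case (Suc p)
  have "coeff ([:b x, a x:] ^ Suc p * P x) k = b x * coeff ([:b x, a x:] ^ p * P x) k +
      (case k of 0 \<Rightarrow> 0 | Suc j \<Rightarrow> a x * coeff ([:b x, a x:] ^ p * P x) j)" for x
    by (simp only: power_Suc mult.assoc) (simp add: coeff_pCons split: nat.split)
  then show ?case
    using Suc assms by (cases k) (auto intro!: continuous_intros)
qed

text \<open>Setting \<open>z1 = 1\<close> turns the defining identity into an identity of
  polynomials in \<open>z\<close>, and coefficients are compared. With \<alpha>, \<beta> the first
  column of \<open>g\<close>, the linear factors are the substituted arguments
  \<open>cnj \<beta> + cnj \<alpha> X\<close> and \<open>\<alpha> - \<beta> X\<close>.\<close>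

lemma wigner_D_coeff:
  assumes l: "l = real n / 2" and "j \<le> n" "k \<le> n"
  shows "of_real (sqrt (real (n choose k))) * wigner_D l g (real k - l) (real j - l) =
    of_real (sqrt (real (n choose j))) *
      coeff ([:cnj (g $ 2 $ 1), cnj (g $ 1 $ 1):] ^ j * [:g $ 1 $ 1, - (g $ 2 $ 1):] ^ (n - j)) k"
    (is "_ = ?b * coeff ?P k")
proof -
  have "2 * l = real n"
    using l by simp
  then have hn: "l \<in> half_nats" and j: "real j - l \<in> weights l"
    using assms by (simp_all only: half_nats_def weights_eq mem_Collect_eq of_nat_in_Nats) auto
  \<comment> \<open>The degree bound lets \<open>poly ?P z\<close> be expanded over the same range
    \<open>k \<le> n\<close> as the left-hand side.\<close>
  have "degree ([:b, a:] ^ p) \<le> p" for a b :: complex and p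
    by (rule order.trans[OF degree_power_le]) simp
  then have "degree ?P \<le> j + (n - j)"
    by (intro order.trans[OF degree_mult_le] add_mono)
  then have deg: "degree ?P \<le> n"
    using assms by simp
  have "(\<Sum>k\<le>n. (of_real (sqrt (real (n choose k))) * wigner_D l g (real k - l) (real j - l)) * z ^ k) =
      (\<Sum>k\<le>n. (?b * coeff ?P k) * z ^ k)" for z
  proof -
    have "(\<Sum>k\<le>n. (of_real (sqrt (real (n choose k))) * wigner_D l g (real k - l) (real j - l)) * z ^ k) =
        ?b * poly ?P z"
      using wigner_D_identity[OF hn j, of z 1 g]
      unfolding sum_weights_psi[OF l] wigner_psi_nat[OF l assms(2)]
      by (simp add: poly_power algebra_simps)
    also have "poly ?P z = (\<Sum>k\<le>n. coeff ?P k * z ^ k)"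
      using deg by (subst poly_altdef, intro sum.mono_neutral_left) (auto simp: coeff_eq_0)
    finally show ?thesis
      by (simp add: sum_distrib_left mult.assoc)
  qed
  then show ?thesis
    using polyfun_eq_coeffs[of "\<lambda>k. of_real (sqrt (real (n choose k))) * wigner_D l g (real k - l) (real j - l)" n
      "\<lambda>k. ?b * coeff ?P k"] assms(3) by blast
qed

text \<open>By the coefficient formula an entry is a polynomial in entries of \<open>g\<close> and
  their conjugates. Continuity on the whole matrix space makes it available on the closure of
  \<open>SU2\<close>.\<close>

lemma continuous_wigner_D:
  assumes "l \<in> half_nats" "m \<in> weights l" "s \<in> weights l"
  shows "continuous_on UNIV (\<lambda>g. wigner_D l g m s)"
proof -
  obtain n where "2 * l = real n"
    using assms(1) by (auto simp: half_nats_def elim: Nats_cases)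
  then have l: "l = real n / 2" by simp
  obtain j k where j: "j \<le> n" "s = real j - l" and k: "k \<le> n" "m = real k - l"
    using assms by (auto simp: weights_eq[OF l])
  have P: "continuous_on UNIV (\<lambda>g :: complex ^ 2 ^ 2. coeff ([:g $ 1 $ 1, - (g $ 2 $ 1):] ^ (n - j)) i)" for i
    using continuous_coeff_linear_power_mult[of UNIV "\<lambda>g. - (g $ 2 $ 1)"
        "\<lambda>g :: complex ^ 2 ^ 2. g $ 1 $ 1" "\<lambda>_. 1" "n - j" i]
    by (simp add: continuous_intros)
  have "wigner_D l g m s = of_real (sqrt (real (n choose j))) *
      coeff ([:cnj (g $ 2 $ 1), cnj (g $ 1 $ 1):] ^ j * [:g $ 1 $ 1, - (g $ 2 $ 1):] ^ (n - j)) k /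
      of_real (sqrt (real (n choose k)))" for g
    unfolding j k wigner_D_coeff[OF l j(1) k(1), symmetric] using k by simp
  then show ?thesis
    by (simp only:) (intro continuous_intros continuous_coeff_linear_power_mult P, use k in auto)
qed

lemma measurable_wigner_D:
  assumes "l \<in> half_nats" "m \<in> weights l" "s \<in> weights l"
  shows "(\<lambda>g. wigner_D l g m s) \<in> borel_measurable borel_SU2"
  using continuous_wigner_D[OF assms]
  by (intro measurable_restrict_space1 borel_measurable_continuous_onI)

text \<open>Compactness: \<open>SU2\<close> is bounded, so each continuous entry is bounded on its
  compact closure, and the finitely many entries share one constant.\<close>

lemma wigner_D_bounded:
  assumes "l \<in> half_nats"
  shows "\<exists>C. \<forall>g\<in>SU2. \<forall>m\<in>weights l. \<forall>s\<in>weights l. cmod (wigner_D l g m s) \<le> C"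
proof -
  have "\<exists>C. \<forall>g\<in>SU2. cmod (wigner_D l g m s) \<le> C" if "m \<in> weights l" "s \<in> weights l" for m s
  proof -
    have "compact ((\<lambda>g. wigner_D l g m s) ` closure SU2)"
      using bounded_SU2 continuous_on_subset[OF continuous_wigner_D[OF assms that]]
      by (intro compact_continuous_image) auto
    then show ?thesis
      using closure_subset by (fastforce dest!: compact_imp_bounded simp: bounded_iff)
  qed
  then obtain C where C: "\<And>m s g. m \<in> weights l \<Longrightarrow> s \<in> weights l \<Longrightarrow> g \<in> SU2 \<Longrightarrow>
      cmod (wigner_D l g m s) \<le> C m s"
    by metis
  \<comment> \<open>The common constant is the sum of the absolute values of all the individual
    bounds.\<close>
  have "cmod (wigner_D l g m s) \<le> (\<Sum>m\<in>weights l. \<Sum>s\<in>weights l. \<bar>C m s\<bar>)"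
    if "g \<in> SU2" "m \<in> weights l" "s \<in> weights l" for g m s
  proof -
    have "cmod (wigner_D l g m s) \<le> \<bar>C m s\<bar>"
      using C[OF that(2,3,1)] by simp
    also have "\<dots> \<le> (\<Sum>s\<in>weights l. \<bar>C m s\<bar>)"
      using that finite_weights[OF assms] by (intro member_le_sum) auto
    also have "\<dots> \<le> (\<Sum>m\<in>weights l. \<Sum>s\<in>weights l. \<bar>C m s\<bar>)"
      using that finite_weights[OF assms]
      by (intro member_le_sum[of m _ "\<lambda>m. \<Sum>s\<in>weights l. \<bar>C m s\<bar>"] sum_nonneg) auto
    finally show ?thesis .
  qed
  then show ?thesis by blast
qed

text \<open>The substitution attached to \<open>g\<close> multiplies the vector of
  \<open>z0\<close>, \<open>z1\<close> by the conjugate transpose of \<open>g\<close>, which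
  reverses products. Substituting for \<open>g\<close> and then for \<open>h\<close> thus gives the
  defining identity of \<open>g ** h\<close>, whose solution is unique.\<close>

lemma wigner_D_mult:
  assumes "l \<in> half_nats" "m \<in> weights l" "s \<in> weights l" "g \<in> SU2" "h \<in> SU2"
  shows "wigner_D l (g ** h) m s = (\<Sum>k\<in>weights l. wigner_D l g m k * wigner_D l h k s)"
proof (rule wigner_D_unique[OF assms(1,3,2)])
  fix z0 z1
  define w0 where "w0 = cnj (g $ 1 $ 1) * z0 + cnj (g $ 2 $ 1) * z1"
  define w1 where "w1 = - (g $ 2 $ 1) * z0 + g $ 1 $ 1 * z1"
  have "(\<Sum>m\<in>weights l. wigner_psi l m z0 z1 * (\<Sum>k\<in>weights l. wigner_D l g m k * wigner_D l h k s)) =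
      (\<Sum>k\<in>weights l. (\<Sum>m\<in>weights l. wigner_psi l m z0 z1 * wigner_D l g m k) * wigner_D l h k s)"
    by (simp only: sum_distrib_left sum_distrib_right mult.assoc) (rule sum.swap)
  also have "\<dots> = (\<Sum>k\<in>weights l. wigner_psi l k w0 w1 * wigner_D l h k s)"
    using wigner_D_identity[OF assms(1)] by (intro sum.cong) (auto simp: w0_def w1_def)
  also have "\<dots> = wigner_psi l s (cnj (h $ 1 $ 1) * w0 + cnj (h $ 2 $ 1) * w1)
      (- (h $ 2 $ 1) * w0 + h $ 1 $ 1 * w1)"
    by (rule wigner_D_identity[OF assms(1,3)])
  \<comment> \<open>\<open>SU2_form\<close> expresses the second column of \<open>g\<close>, which
    enters the first column of \<open>g ** h\<close>, through the first.\<close>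
  also have "cnj (h $ 1 $ 1) * w0 + cnj (h $ 2 $ 1) * w1 =
      cnj ((g ** h) $ 1 $ 1) * z0 + cnj ((g ** h) $ 2 $ 1) * z1"
    using SU2_form[OF assms(4)]
    by (simp add: w0_def w1_def matrix_matrix_mult_def sum_2 algebra_simps)
  also have "- (h $ 2 $ 1) * w0 + h $ 1 $ 1 * w1 = - ((g ** h) $ 2 $ 1) * z0 + (g ** h) $ 1 $ 1 * z1"
    using SU2_form[OF assms(4)]
    by (simp add: w0_def w1_def matrix_matrix_mult_def sum_2 algebra_simps)
  finally show "(\<Sum>m\<in>weights l. wigner_psi l m z0 z1 *
        (\<Sum>k\<in>weights l. wigner_D l g m k * wigner_D l h k s)) =
      wigner_psi l s (cnj ((g ** h) $ 1 $ 1) * z0 + cnj ((g ** h) $ 2 $ 1) * z1)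
        (- ((g ** h) $ 2 $ 1) * z0 + (g ** h) $ 1 $ 1 * z1)" .
qed

lemma wigner_act_mult:
  assumes "l \<in> half_nats" "g \<in> SU2" "h \<in> SU2"
  shows "wigner_act l (g ** h) v = wigner_act l g (wigner_act l h v)"
proof
  fix m
  show "wigner_act l (g ** h) v m = wigner_act l g (wigner_act l h v) m"
  proof (cases "m \<in> weights l")
    case True
    have "(\<Sum>s\<in>weights l. wigner_D l (g ** h) m s * v s) =
        (\<Sum>s\<in>weights l. \<Sum>k\<in>weights l. wigner_D l g m k * wigner_D l h k s * v s)"
      using wigner_D_mult[OF assms(1) True _ assms(2,3)]
      by (intro sum.cong) (auto simp: sum_distrib_right)
    also have "\<dots> = (\<Sum>k\<in>weights l. wigner_D l g m k * (\<Sum>s\<in>weights l. wigner_D l h k s * v s))"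
      by (subst sum.swap) (simp add: sum_distrib_left mult.assoc)
    finally show ?thesis
      using True by (simp add: wigner_act_def)
  qed (simp add: wigner_act_def)
qed

section \<open>Measurability of the group multiplication and of the action\<close>

lemma measurable_mult_SU2:
  assumes "g \<in> SU2"
  shows "(\<lambda>h. g ** h) \<in> measurable borel_SU2 borel_SU2"
proof (rule measurable_restrict_space3)
  have "continuous_on UNIV (\<lambda>h :: complex ^ 2 ^ 2. g ** h)"
    unfolding matrix_matrix_mult_def by (intro continuous_intros)
  then show "(\<lambda>h :: complex ^ 2 ^ 2. g ** h) \<in> measurable borel borel"
    by (rule borel_measurable_continuous_onI)
qed (use assms SU2_mult in auto)

text \<open>Measurability into the product is checked coordinatewise, for an arbitrary
  \<open>I\<close>; each coordinate is a sum of products of a Wigner entry in \<open>g\<close> and a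
  coordinate of \<open>v\<close>.\<close>

lemma measurable_wigner_act_collection:
  assumes "\<And>i. i \<in> I \<Longrightarrow> l i \<in> half_nats"
  shows "(\<lambda>(g, v). \<lambda>i\<in>I. wigner_act (l i) g (v i)) \<in>
    measurable (borel_SU2 \<Otimes>\<^sub>M Pi\<^sub>M I (\<lambda>i. vec_space (l i))) (Pi\<^sub>M I (\<lambda>i. vec_space (l i)))"
  unfolding wigner_act_def case_prod_beta'
proof (intro measurable_restrict borel_measurable_sum borel_measurable_times)
  fix i m s assume i: "i \<in> I" and ms: "m \<in> weights (l i)" "s \<in> weights (l i)"
  show "(\<lambda>x. wigner_D (l i) (fst x) m s) \<in>
      borel_measurable (borel_SU2 \<Otimes>\<^sub>M Pi\<^sub>M I (\<lambda>i. vec_space (l i)))"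
    using measurable_wigner_D[OF assms[OF i] ms] by (rule measurable_compose[OF measurable_fst])
  have "(\<lambda>v. v i) \<in> measurable (Pi\<^sub>M I (\<lambda>i. vec_space (l i))) (vec_space (l i))"
    using i by (rule measurable_component_singleton)
  moreover have "(\<lambda>w. w s) \<in> borel_measurable (vec_space (l i))"
    using ms(2) by (rule measurable_component_singleton)
  ultimately show "(\<lambda>x. snd x i s) \<in> borel_measurable (borel_SU2 \<Otimes>\<^sub>M Pi\<^sub>M I (\<lambda>i. vec_space (l i)))"
    by (rule measurable_compose[OF measurable_compose[OF measurable_snd]])
qed

section \<open>Concatenated random vectors\<close>

text \<open>The direct sum of two matrices, which turns a pair of vectors into one vector under a
  single representation.\<close>

definition block_diag ::
  "('a \<Rightarrow> 'a \<Rightarrow> complex) \<Rightarrow> ('b \<Rightarrow> 'b \<Rightarrow> complex) \<Rightarrow> 'a + 'b \<Rightarrow> 'a + 'b \<Rightarrow> complex" where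
  "block_diag A B = case_sum (\<lambda>m. case_sum (A m) (\<lambda>_. 0)) (\<lambda>m. case_sum (\<lambda>_. 0) (B m))"

lemma block_diag_simps [simp]:
  "block_diag A B (Inl m) (Inl s) = A m s"
  "block_diag A B (Inl m) (Inr t) = 0"
  "block_diag A B (Inr n) (Inl s) = 0"
  "block_diag A B (Inr n) (Inr t) = B n t"
  by (simp_all add: block_diag_def)

text \<open>The direct sum of two Wigner representations is again measurable, bounded and
  multiplicative. \<open>U\<close> and \<open>U'\<close> are functions of the same \<open>Y\<close>,
  so the moments mixing the two blocks are covered too.\<close>

lemma weakly2_wigner_invariant_iff:
  assumes "independent_left_invariant M borel_SU2 matrix_matrix_mult \<gamma> S Y"
    and l: "l \<in> half_nats" "l' \<in> half_nats"
    and U [measurable]: "\<And>m. m \<in> weights l \<Longrightarrow> (\<lambda>y. U y m) \<in> borel_measurable S"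
    and U' [measurable]: "\<And>m. m \<in> weights l' \<Longrightarrow> (\<lambda>y. U' y m) \<in> borel_measurable S"
    and fsm: "finite_second_moments M (weights l) (\<lambda>\<omega>. U (Y \<omega>))"
      "finite_second_moments M (weights l') (\<lambda>\<omega>. U' (Y \<omega>))"
  shows "(\<forall>g\<in>SU2. weakly2_equiv M (weights l <+> weights l') (\<lambda>\<omega>. case_sum (U (Y \<omega>)) (U' (Y \<omega>)))
        (\<lambda>\<omega>. case_sum (wigner_act l g (U (Y \<omega>))) (wigner_act l' g (U' (Y \<omega>))))) \<longleftrightarrow>
    weakly2_equiv M (weights l <+> weights l') (\<lambda>\<omega>. case_sum (U (Y \<omega>)) (U' (Y \<omega>)))
        (\<lambda>\<omega>. case_sum (wigner_act l (\<gamma> \<omega>) (U (Y \<omega>))) (wigner_act l' (\<gamma> \<omega>) (U' (Y \<omega>))))"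
proof -
  interpret independent_left_invariant M borel_SU2 "matrix_matrix_mult" \<gamma> S Y by fact
  let ?J = "weights l <+> weights l'"
  define R where "R g = block_diag (wigner_D l g) (wigner_D l' g)" for g
  define X where "X y = case_sum (U y) (U' y)" for y
  note fin = finite_weights[OF l(1)] finite_weights[OF l(2)]
  have RX: "(\<Sum>b\<in>?J. R g a b * X y b) = case_sum (wigner_act l g (U y)) (wigner_act l' g (U' y)) a"
    if "a \<in> ?J" for g a y
    using that fin by (auto simp: sum.Plus R_def X_def wigner_act_def)
  obtain C C' where C: "\<And>g m s. g \<in> SU2 \<Longrightarrow> m \<in> weights l \<Longrightarrow> s \<in> weights l \<Longrightarrow> cmod (wigner_D l g m s) \<le> C"
    and C': "\<And>g m s. g \<in> SU2 \<Longrightarrow> m \<in> weights l' \<Longrightarrow> s \<in> weights l' \<Longrightarrow> cmod (wigner_D l' g m s) \<le> C'"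
    using wigner_D_bounded[OF l(1)] wigner_D_bounded[OF l(2)] by metis
  have "(\<forall>g\<in>space borel_SU2. weakly2_equiv M ?J (\<lambda>\<omega>. X (Y \<omega>)) (\<lambda>\<omega> a. \<Sum>b\<in>?J. R g a b * X (Y \<omega>) b)) \<longleftrightarrow>
    weakly2_equiv M ?J (\<lambda>\<omega>. X (Y \<omega>)) (\<lambda>\<omega> a. \<Sum>b\<in>?J. R (\<gamma> \<omega>) a b * X (Y \<omega>) b)"
  \<comment> \<open>The \<open>0\<close> in the maximum bounds the off-diagonal blocks.\<close>
  proof (rule weakly2_invariant_iff[where C = "max 0 (max C C')"])
    show "finite ?J" using fin by simp
    show "(\<lambda>y. X y a) \<in> borel_measurable S" if "a \<in> ?J" for a
      using that by (auto simp: X_def)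
    show "finite_second_moments M ?J (\<lambda>\<omega>. X (Y \<omega>))"
      using fsm by (auto simp: finite_second_moments_def X_def)
    show "(\<lambda>g. R g a b) \<in> borel_measurable borel_SU2" if "a \<in> ?J" "b \<in> ?J" for a b
      using that l by (auto simp: R_def intro: measurable_wigner_D)
    show "cmod (R g a b) \<le> max 0 (max C C')" if "g \<in> space borel_SU2" "a \<in> ?J" "b \<in> ?J" for g a b
      using that C C' by (auto simp: R_def space_restrict_space le_max_iff_disj)
    show "R (g ** h) a c = (\<Sum>b\<in>?J. R g a b * R h b c)"
      if "g \<in> space borel_SU2" "h \<in> space borel_SU2" "a \<in> ?J" "c \<in> ?J" for g h a c
      using that fin l by (auto simp: R_def sum.Plus space_restrict_space wigner_D_mult)
  qed
  also have "weakly2_equiv M ?J (\<lambda>\<omega>. X (Y \<omega>)) (\<lambda>\<omega> a. \<Sum>b\<in>?J. R (\<gamma> \<omega>) a b * X (Y \<omega>) b) \<longleftrightarrow>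
      weakly2_equiv M ?J (\<lambda>\<omega>. case_sum (U (Y \<omega>)) (U' (Y \<omega>)))
        (\<lambda>\<omega>. case_sum (wigner_act l (\<gamma> \<omega>) (U (Y \<omega>))) (wigner_act l' (\<gamma> \<omega>) (U' (Y \<omega>))))"
    by (rule weakly2_equiv_cong) (simp_all add: RX, simp add: X_def)
  also have "(\<forall>g\<in>space borel_SU2. weakly2_equiv M ?J (\<lambda>\<omega>. X (Y \<omega>)) (\<lambda>\<omega> a. \<Sum>b\<in>?J. R g a b * X (Y \<omega>) b)) \<longleftrightarrow>
      (\<forall>g\<in>SU2. weakly2_equiv M ?J (\<lambda>\<omega>. case_sum (U (Y \<omega>)) (U' (Y \<omega>)))
        (\<lambda>\<omega>. case_sum (wigner_act l g (U (Y \<omega>))) (wigner_act l' g (U' (Y \<omega>)))))"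
    by (intro ball_cong weakly2_equiv_cong) (simp_all add: RX space_restrict_space, simp add: X_def)
  finally show ?thesis .
qed

section \<open>Strong and 2-weak invariance of collections\<close>

theorem theorem55:
  fixes M :: "'w measure" and I :: "'i set" and l :: "'i \<Rightarrow> real"
    and V :: "'i \<Rightarrow> 'w \<Rightarrow> real \<Rightarrow> complex" and \<gamma> :: "'w \<Rightarrow> complex ^ 2 ^ 2"
  assumes "prob_space M"
    and "\<And>i. i \<in> I \<Longrightarrow> l i \<in> half_nats"
    and "\<And>i. i \<in> I \<Longrightarrow> V i \<in> measurable M (vec_space (l i))"
    and "\<gamma> \<in> measurable M borel_SU2"
    and "haar_prob_SU2 (distr M borel_SU2 \<gamma>)"
    and "indep_of_collection M I l V \<gamma>"
  shows "(strongly_D_invariant M I l V \<longleftrightarrow>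
            joint_law M I l V = joint_law M I l (\<lambda>i \<omega>. wigner_act (l i) (\<gamma> \<omega>) (V i \<omega>)))
       \<and> ((\<forall>i\<in>I. finite_second_moments M (weights (l i)) (V i)) \<longrightarrow>
           (weakly2_D_invariant M I l V \<longleftrightarrow>
            collection_weakly2_equiv M I l V (\<lambda>i \<omega>. wigner_act (l i) (\<gamma> \<omega>) (V i \<omega>))))"
proof -
  \<comment> \<open>The collection becomes a single random element \<open>Y\<close> of a product
    space, so \<open>indep_of_collection\<close> is exactly independence of \<open>\<gamma>\<close>
    and \<open>Y\<close>.\<close>
  define S where "S = Pi\<^sub>M I (\<lambda>i. vec_space (l i))"
  define Y where "Y \<omega> = (\<lambda>i\<in>I. V i \<omega>)" for \<omega>
  have space_SU2: "space borel_SU2 = SU2"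
    by (simp add: space_restrict_space)
  interpret prob_space M by fact
  interpret independent_left_invariant M borel_SU2 "matrix_matrix_mult" \<gamma> S Y
  proof
    show "\<gamma> \<in> measurable M borel_SU2" by fact
    show "Y \<in> measurable M S"
      unfolding S_def Y_def using assms(3) by (rule measurable_restrict)
    show "matrix_matrix_mult g \<in> measurable borel_SU2 borel_SU2" if "g \<in> space borel_SU2" for g
      using that measurable_mult_SU2 unfolding space_SU2 by blast
    show "distr (distr M borel_SU2 \<gamma>) borel_SU2 (matrix_matrix_mult g) = distr M borel_SU2 \<gamma>"
      if "g \<in> space borel_SU2" for g
      using assms(5) that unfolding haar_prob_SU2_def space_SU2 by blast
    show "indep_set {\<gamma> -` A \<inter> space M | A. A \<in> sets borel_SU2} {Y -` B \<inter> space M | B. B \<in> sets S}"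
      using assms(6) unfolding indep_of_collection_def S_def Y_def .
  qed
  define act where "act g v = (\<lambda>i\<in>I. wigner_act (l i) g (v i))" for g and v :: "'i \<Rightarrow> real \<Rightarrow> complex"
  have "(\<forall>g\<in>space borel_SU2. distr M S Y = distr M S (\<lambda>\<omega>. act g (Y \<omega>))) \<longleftrightarrow>
      distr M S Y = distr M S (\<lambda>\<omega>. act (\<gamma> \<omega>) (Y \<omega>))"
  proof (rule distr_invariant_iff)
    show "(\<lambda>(g, y). act g y) \<in> measurable (borel_SU2 \<Otimes>\<^sub>M S) S"
      unfolding act_def S_def using assms(2) by (rule measurable_wigner_act_collection)
    show "act (g ** h) y = act g (act h y)" if "g \<in> space borel_SU2" "h \<in> space borel_SU2" for g h y
      using that assms(2) unfolding act_def space_SU2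
      by (intro restrict_ext) (simp add: wigner_act_mult)
  qed
  moreover have "joint_law M I l V = distr M S Y"
    by (simp add: joint_law_def S_def Y_def[abs_def])
  \<comment> \<open>A general \<open>f\<close> covers both a constant \<open>g\<close> and the
    random \<open>\<gamma>\<close>.\<close>
  moreover have "joint_law M I l (\<lambda>i \<omega>. wigner_act (l i) (f \<omega>) (V i \<omega>)) = distr M S (\<lambda>\<omega>. act (f \<omega>) (Y \<omega>))" for f
    by (simp add: joint_law_def S_def Y_def act_def cong: restrict_cong)
  ultimately have a: "strongly_D_invariant M I l V \<longleftrightarrow>
      joint_law M I l V = joint_law M I l (\<lambda>i \<omega>. wigner_act (l i) (\<gamma> \<omega>) (V i \<omega>))"
    by (simp add: strongly_D_invariant_def space_SU2)
  have b: "weakly2_D_invariant M I l V \<longleftrightarrow>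
      collection_weakly2_equiv M I l V (\<lambda>i \<omega>. wigner_act (l i) (\<gamma> \<omega>) (V i \<omega>))"
    if fsm: "\<forall>i\<in>I. finite_second_moments M (weights (l i)) (V i)"
  proof -
    \<comment> \<open>The vectors \<open>V i\<close> and \<open>V j\<close> are recovered from
      \<open>Y\<close> by evaluation, which supplies \<open>U\<close> and \<open>U'\<close>.\<close>
    have coord: "(\<lambda>y. y i m) \<in> borel_measurable S" if "i \<in> I" "m \<in> weights (l i)" for i m
    proof -
      have "(\<lambda>y. y i) \<in> measurable S (vec_space (l i))"
        unfolding S_def using that(1) by (rule measurable_component_singleton)
      then show ?thesis
        using measurable_component_singleton[OF that(2)] by (rule measurable_compose)
    qed
    have "(\<forall>g\<in>SU2. weakly2_equiv M (weights (l i) <+> weights (l j)) (\<lambda>\<omega>. case_sum (V i \<omega>) (V j \<omega>))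
          (\<lambda>\<omega>. case_sum (wigner_act (l i) g (V i \<omega>)) (wigner_act (l j) g (V j \<omega>)))) \<longleftrightarrow>
        weakly2_equiv M (weights (l i) <+> weights (l j)) (\<lambda>\<omega>. case_sum (V i \<omega>) (V j \<omega>))
          (\<lambda>\<omega>. case_sum (wigner_act (l i) (\<gamma> \<omega>) (V i \<omega>)) (wigner_act (l j) (\<gamma> \<omega>) (V j \<omega>)))"
      if ij: "i \<in> I" "j \<in> I" for i j
      using weakly2_wigner_invariant_iff[OF independent_left_invariant_axioms assms(2)[OF ij(1)] assms(2)[OF ij(2)]
          coord[OF ij(1)] coord[OF ij(2)]] fsm ij
      by (simp add: Y_def)
    \<comment> \<open>The equivalence for each pair suffices, as the quantifiers over
      \<open>g\<close> and over \<open>i\<close>, \<open>j\<close> commute.\<close>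
    then show ?thesis
      unfolding weakly2_D_invariant_def collection_weakly2_equiv_def by blast
  qed
  show ?thesis
    using a b by blast
qed

end
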